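(* Two matrices $A,B\in M_2(\mathbb{H})$ are $\mathrm{Sp}(2)$-equivalent if and only if the following six equations hold: $$\mathrm{Tr}(A^i)=\mathrm{Tr}(B^i)\ \text{ for } i\in\{1,2,3,4\};\qquad \mathrm{Tr}(AA^* )=\mathrm{Tr}(BB^* );\qquad \mathrm{Tr}(A^2A^{*2})=\mathrm{Tr}(B^2B^{*2}).$$ Moreover, the set of six invariants $\mathrm{Tr}(A),\mathrm{Tr}(A^2),\mathrm{Tr}(A^3),\mathrm{Tr}(A^4),\mathrm{Tr}(AA^* ),\mathrm{Tr}(A^2A^{*2})$ is a minimal set of invariants with this property, i.e. no proper subset of these six functions on $M_2(\mathbb{H})$ separates the $\mathrm{Sp}(2)$-equivalence classes.
   Context: $\mathbb{H}$ is the division ring of real quaternions and $M_n(\mathbb{H})$ the real algebra of $n\times n$ quaternionic matrices. For $A\in M_n(\mathbb{H})$, $A^*$ is the conjugate transpose (using quaternionic conjugation), and $A^{*2}=(A^* )^2$. $\mathrm{Sp}(n)=\{U\in M_n(\mathbb{H}):U^*U=I_n\}$. Matrices $A,B\in M_n(\mathbb{H})$ are $\mathrm{Sp}(n)$-equivalent if $A=UBU^{-1}$ for some $U\in\mathrm{Sp}(n)$. The quaternionic trace of $A=[a_{ij}]\in M_n(\mathbb{H})$ is $\mathrm{Tr}(A)=\sum_{i=1}^n(a_{ii}+\overline{a_{ii}})=2\,\mathrm{Re}\left(\sum_i a_{ii}\right)\in\mathbb{R}$. *)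

theory Defs
  imports "HOL-Analysis.Analysis"
begin

text \<open>\<open>Quat a b c d\<close> is the real quaternion \<open>a + b i + c j + d k\<close>.\<close>

datatype quat = Quat (qRe: real) (qIm1: real) (qIm2: real) (qIm3: real)

instantiation quat :: ab_group_add
begin

definition "0 = Quat 0 0 0 0"

definition "x + y = Quat (qRe x + qRe y) (qIm1 x + qIm1 y) (qIm2 x + qIm2 y) (qIm3 x + qIm3 y)"

definition "- x = Quat (- qRe x) (- qIm1 x) (- qIm2 x) (- qIm3 x)"

definition "x - y = Quat (qRe x - qRe y) (qIm1 x - qIm1 y) (qIm2 x - qIm2 y) (qIm3 x - qIm3 y)"

instance
  by standard
    (simp_all add: zero_quat_def plus_quat_def uminus_quat_def minus_quat_def)

end

definition qconj :: "quat \<Rightarrow> quat" where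
  "qconj x = Quat (qRe x) (- qIm1 x) (- qIm2 x) (- qIm3 x)"

definition qnorm2 :: "quat \<Rightarrow> real" where
  "qnorm2 x = (qRe x)\<^sup>2 + (qIm1 x)\<^sup>2 + (qIm2 x)\<^sup>2 + (qIm3 x)\<^sup>2"

instantiation quat :: division_ring
begin

definition "1 = Quat 1 0 0 0"

definition
  "x * y = Quat
    (qRe x * qRe y - qIm1 x * qIm1 y - qIm2 x * qIm2 y - qIm3 x * qIm3 y)
    (qRe x * qIm1 y + qIm1 x * qRe y + qIm2 x * qIm3 y - qIm3 x * qIm2 y)
    (qRe x * qIm2 y - qIm1 x * qIm3 y + qIm2 x * qRe y + qIm3 x * qIm1 y)
    (qRe x * qIm3 y + qIm1 x * qIm2 y - qIm2 x * qIm1 y + qIm3 x * qRe y)"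

definition
  "inverse x = Quat (qRe x / qnorm2 x) (- qIm1 x / qnorm2 x)
    (- qIm2 x / qnorm2 x) (- qIm3 x / qnorm2 x)"

definition "x div y = x * inverse (y :: quat)"

instance
proof
  fix x y z :: quat
  show "(x * y) * z = x * (y * z)"
    by (simp add: times_quat_def algebra_simps)
  show "1 * x = x" "x * 1 = x"
    by (simp_all add: times_quat_def one_quat_def)
  show "(x + y) * z = x * z + y * z" "x * (y + z) = x * y + x * z"
    by (simp_all add: times_quat_def plus_quat_def algebra_simps)
  show "(0 :: quat) \<noteq> 1"
    by (simp add: zero_quat_def one_quat_def)
  show "inverse (0 :: quat) = 0"
    by (simp add: inverse_quat_def zero_quat_def)
  show "x div y = x * inverse y"
    by (simp add: divide_quat_def)
  assume "x \<noteq> 0"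
  then have "qnorm2 x \<noteq> 0"
    by (cases x) (auto simp: qnorm2_def zero_quat_def add_nonneg_eq_0_iff)
  then have n: "(qRe x * qRe x + qIm1 x * qIm1 x + qIm2 x * qIm2 x + qIm3 x * qIm3 x) / qnorm2 x = 1"
    by (simp add: qnorm2_def power2_eq_square)
  have "inverse x * x = Quat ((qRe x * qRe x + qIm1 x * qIm1 x + qIm2 x * qIm2 x
      + qIm3 x * qIm3 x) / qnorm2 x) 0 0 0"
    "x * inverse x = Quat ((qRe x * qRe x + qIm1 x * qIm1 x + qIm2 x * qIm2 x
      + qIm3 x * qIm3 x) / qnorm2 x) 0 0 0"
    by (simp_all add: times_quat_def inverse_quat_def add_divide_distrib)
  then show "inverse x * x = 1" "x * inverse x = 1"
    by (simp_all add: n one_quat_def)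
qed

end

lemma quat_units:
  "Quat 0 1 0 0 * Quat 0 1 0 0 = - 1"
  "Quat 0 0 1 0 * Quat 0 0 1 0 = - 1"
  "Quat 0 0 0 1 * Quat 0 0 0 1 = - 1"
  "Quat 0 1 0 0 * Quat 0 0 1 0 = Quat 0 0 0 1"
  by (simp_all add: times_quat_def one_quat_def uminus_quat_def)

lemma qconj_mult: "qconj (x * y) = qconj y * qconj x"
  by (simp add: qconj_def times_quat_def algebra_simps)

definition ctranspose :: "quat ^ 'n ^ 'm \<Rightarrow> quat ^ 'm ^ 'n" where
  "ctranspose A = (\<chi> i j. qconj (A $ j $ i))"

text \<open>The library's power \<open>(^)\<close> on \<open>quat ^ 'n ^ 'n\<close> is the entrywise one, so the
  power with respect to the matrix product is defined here.\<close>

primrec mpow :: "quat ^ 'n ^ 'n \<Rightarrow> nat \<Rightarrow> quat ^ 'n ^ 'n" where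
  "mpow A 0 = mat 1"
| "mpow A (Suc k) = A ** mpow A k"

definition Sp :: "(quat ^ 'n ^ 'n) set" where
  "Sp = {U. ctranspose U ** U = mat 1}"

definition Sp_equiv :: "quat ^ 'n ^ 'n \<Rightarrow> quat ^ 'n ^ 'n \<Rightarrow> bool" where
  "Sp_equiv A B \<longleftrightarrow> (\<exists>U \<in> Sp. A = U ** B ** matrix_inv U)"

text \<open>The sum below is a real quaternion (lemma \<open>Tr_real\<close>); taking \<open>qRe\<close> only
  turns it into an element of type \<open>real\<close>.\<close>

definition Tr :: "quat ^ 'n ^ 'n \<Rightarrow> real" where
  "Tr A = qRe (\<Sum>i\<in>UNIV. A $ i $ i + qconj (A $ i $ i))"

lemma Tr_real: "(\<Sum>i\<in>UNIV. A $ i $ i + qconj (A $ i $ i)) = Quat (Tr A) 0 0 0"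
proof -
  have "qIm1 (\<Sum>i\<in>S. f i + qconj (f i)) = 0 \<and> qIm2 (\<Sum>i\<in>S. f i + qconj (f i)) = 0 \<and>
      qIm3 (\<Sum>i\<in>S. f i + qconj (f i)) = 0" for S :: "'a set" and f
    by (induction S rule: infinite_finite_induct)
      (auto simp: zero_quat_def plus_quat_def qconj_def)
  then show ?thesis
    unfolding Tr_def by (intro quat.expand) simp
qed

lemma Tr_eq: "Tr A = 2 * qRe (\<Sum>i\<in>UNIV. A $ i $ i)"
proof -
  have "qRe (\<Sum>i\<in>S. f i + qconj (f i)) = 2 * qRe (\<Sum>i\<in>S. f i)" for S :: "'a set" and f
    by (induction S rule: infinite_finite_induct)
      (auto simp: zero_quat_def plus_quat_def qconj_def)
  then show ?thesis
    unfolding Tr_def by simp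
qed

definition separates_Sp_classes :: "(quat ^ 'n ^ 'n \<Rightarrow> real) set \<Rightarrow> bool" where
  "separates_Sp_classes F \<longleftrightarrow> (\<forall>A B. (\<forall>f\<in>F. f A = f B) \<longrightarrow> Sp_equiv A B)"

definition six_invariants :: "(quat ^ 2 ^ 2 \<Rightarrow> real) set" where
  "six_invariants =
    {\<lambda>A. Tr A, \<lambda>A. Tr (mpow A 2), \<lambda>A. Tr (mpow A 3), \<lambda>A. Tr (mpow A 4),
     \<lambda>A. Tr (A ** ctranspose A), \<lambda>A. Tr (mpow A 2 ** mpow (ctranspose A) 2)}"

end

theory Submission
  imports Defs "Jordan_Normal_Form.Spectral_Radius"
begin

text \<open>A quaternionic \<open>2 \<times> 2\<close> matrix is unitarily equivalent to an upper triangular one with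
  diagonal entries \<open>\<alpha>\<close>, \<open>\<beta>\<close> in the closed upper half plane, in either order, and with corner
  \<open>q = z + w j\<close>. The traces of the powers are the power sums of \<open>\<alpha>\<close>, \<open>\<beta>\<close> and their
  conjugates and determine the diagonal. The other two traces then determine
  \<open>\<bar>z\<bar>\<^sup>2 + \<bar>w\<bar>\<^sup>2\<close> and \<open>\<bar>\<alpha> q + q \<beta>\<bar>\<^sup>2 = \<bar>\<alpha> + \<beta>\<bar>\<^sup>2 \<bar>z\<bar>\<^sup>2 + \<bar>\<alpha> + cnj \<beta>\<bar>\<^sup>2 \<bar>w\<bar>\<^sup>2\<close>.
  If neither eigenvalue is real this fixes \<open>\<bar>z\<bar>\<close> and \<open>\<bar>w\<bar>\<close>, which diagonal unitary complex
  matrices rotate independently; if one is real, its stabilizer is the whole group of unit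
  quaternions and \<open>\<bar>q\<bar>\<close> suffices.\<close>

no_notation Matrix.vec_index (infixl "$" 100)
hide_const (open) Matrix.mat Matrix.vec

text \<open>Nonemptiness of the complex spectrum, restated for functions on indices so that the
  matrix type with explicit dimensions stays confined to this proof.\<close>

lemma complex_eigenvector_exists:
  fixes m :: "nat \<Rightarrow> nat \<Rightarrow> complex"
  assumes "n > 0"
  shows "\<exists>k v. (\<exists>i<n. v i \<noteq> 0) \<and> (\<forall>i<n. (\<Sum>j<n. m i j * v j) = k * v i)"
proof -
  let ?M = "Matrix.mat n n (\<lambda>(i, j). m i j)"
  have "spectrum ?M \<noteq> {}"
    using assms by (intro spectrum_non_empty[of _ n]) auto
  then obtain k v where "eigenvector ?M v k"
    by (auto simp: spectrum_def eigenvalue_def)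
  then have v: "v \<in> carrier_vec n" and nz: "v \<noteq> 0\<^sub>v n" and eq: "?M *\<^sub>v v = k \<cdot>\<^sub>v v"
    by (auto simp: eigenvector_def)
  show ?thesis
  proof (intro exI[of _ k] exI[of _ "vec_index v"] conjI allI impI)
    show "\<exists>i<n. vec_index v i \<noteq> 0"
      using v nz by (metis carrier_vecD eq_vecI index_zero_vec)
    fix i assume i: "i < n"
    have "vec_index (?M *\<^sub>v v) i = (\<Sum>j<n. m i j * vec_index v j)"
      using i v by (simp add: scalar_prod_def lessThan_atLeast0)
    then show "(\<Sum>j<n. m i j * vec_index v j) = k * vec_index v i"
      using i v eq by simp
  qed
qed

subsection \<open>Quaternions and complex numbers\<close>

lemmas quat_defs = times_quat_def plus_quat_def minus_quat_def uminus_quat_def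
  zero_quat_def one_quat_def qconj_def

definition cq :: "complex \<Rightarrow> quat" where
  "cq z = Quat (Re z) (Im z) 0 0"

definition qJ :: quat where
  "qJ = Quat 0 0 1 0"

lemma cq_simps:
  "cq 0 = 0" "cq 1 = 1" "cq (z + w) = cq z + cq w" "cq (z * w) = cq z * cq w" "cq (- z) = - cq z"
  "cq (cnj z) = qconj (cq z)"
  by (simp_all add: cq_def quat_defs)

lemma cq_eq_iff: "cq z = cq w \<longleftrightarrow> z = w"
  by (auto simp: cq_def complex_eq_iff)

lemma qRe_cq [simp]: "qRe (cq z) = Re z"
  by (simp add: cq_def)

text \<open>\<open>quat\<close> has no real scalar multiplication here, so a real factor is written
  \<open>cq (of_real r)\<close>; being central, it can normalize vectors without changing an
  eigenvalue.\<close>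

lemma cq_of_real_commute: "x * cq (of_real r) = cq (of_real r) * x"
  by (simp add: cq_def quat_defs)

lemma cq_qJ: "cq z * qJ = qJ * cq (cnj z)"
  by (simp add: cq_def qJ_def quat_defs)

lemma quat_complex_decomp:
  obtains z w where "q = cq z + cq w * qJ"
proof
  show "q = cq (Complex (qRe q) (qIm1 q)) + cq (Complex (qIm2 q) (qIm3 q)) * qJ"
    by (cases q) (simp add: cq_def qJ_def quat_defs)
qed

lemma qconj_add: "qconj (x + y) = qconj x + qconj y"
  by (simp add: quat_defs)

lemma qconj_qconj [simp]: "qconj (qconj x) = x"
  by (simp add: quat_defs)

lemma qconj_0_1 [simp]: "qconj 0 = 0" "qconj 1 = 1"
  by (simp_all add: quat_defs)

lemma qRe_add: "qRe (x + y) = qRe x + qRe y"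
  by (simp add: quat_defs)

lemma qRe_mult_commute: "qRe (x * y) = qRe (y * x)"
  by (simp add: quat_defs)

lemma qRe_sum: "qRe (sum f S) = (\<Sum>i\<in>S. qRe (f i))"
  by (induction S rule: infinite_finite_induct) (auto simp: quat_defs)

lemma qconj_sum: "qconj (sum f S) = (\<Sum>i\<in>S. qconj (f i))"
  by (induction S rule: infinite_finite_induct) (auto simp: qconj_add)

lemma qconj_mult_self: "qconj x * x = cq (of_real (qnorm2 x))"
  and mult_qconj_self: "x * qconj x = cq (of_real (qnorm2 x))"
  by (simp_all add: cq_def quat_defs qnorm2_def power2_eq_square)

lemma qnorm2_nonneg [simp]: "qnorm2 x \<ge> 0"
  by (simp add: qnorm2_def)

lemma qnorm2_eq_0_iff: "qnorm2 x = 0 \<longleftrightarrow> x = 0"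
  by (cases x) (auto simp: qnorm2_def zero_quat_def add_nonneg_eq_0_iff)

lemma qnorm2_0_1 [simp]: "qnorm2 0 = 0" "qnorm2 1 = 1"
  by (simp_all add: qnorm2_def quat_defs)

lemma qnorm2_mult: "qnorm2 (x * y) = qnorm2 x * qnorm2 y"
  by (simp add: qnorm2_def times_quat_def power2_eq_square algebra_simps)

lemma qnorm2_qconj [simp]: "qnorm2 (qconj x) = qnorm2 x"
  by (simp add: qnorm2_def qconj_def)

lemma qnorm2_cq: "qnorm2 (cq z) = (cmod z)\<^sup>2"
  by (simp add: qnorm2_def cq_def cmod_power2)

lemma qnorm2_complex_decomp: "qnorm2 (cq z + cq w * qJ) = (cmod z)\<^sup>2 + (cmod w)\<^sup>2"
  by (simp add: qnorm2_def cq_def qJ_def quat_defs cmod_power2)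

lemma qnorm2_eq_1_iff: "qnorm2 x = 1 \<longleftrightarrow> qconj x * x = 1"
  unfolding qconj_mult_self using cq_eq_iff[of "of_real (qnorm2 x)" 1] by (simp add: cq_simps)

lemma qnorm2_eq_1_iff': "qnorm2 x = 1 \<longleftrightarrow> x * qconj x = 1"
  unfolding mult_qconj_self using cq_eq_iff[of "of_real (qnorm2 x)" 1] by (simp add: cq_simps)

text \<open>Conjugation by unit quaternions rotates the imaginary part of \<open>h\<close>, so it
  can be turned into m i, where m is its length.\<close>

lemma quat_conjugate_complex:
  obtains s \<beta> where "qnorm2 s = 1" "Im \<beta> \<ge> 0" "h * s = s * cq \<beta>"
proof -
  define m where "m = sqrt ((qIm1 h)\<^sup>2 + (qIm2 h)\<^sup>2 + (qIm3 h)\<^sup>2)"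
  have m2: "m * m = qIm1 h * qIm1 h + qIm2 h * qIm2 h + qIm3 h * qIm3 h" and m: "m \<ge> 0"
    by (simp_all add: m_def power2_eq_square[symmetric])
  let ?\<beta> = "Complex (qRe h) m"
  have "\<exists>s. s \<noteq> 0 \<and> h * s = s * cq ?\<beta>"
  \<comment> \<open>The exceptional case is h = Re h - m i, where the general witness vanishes;
    there j works, since i j = - j i.\<close>
  proof (cases "qIm2 h = 0 \<and> qIm3 h = 0 \<and> qIm1 h = - m")
    case True
    then show ?thesis
      by (intro exI[of _ qJ]) (simp add: qJ_def cq_def quat_defs)
  next
    case False
    \<comment> \<open>With v the imaginary part of h, the witness is v + m i: since v^2 = - m^2,
      both v (v + m i) and (v + m i) m i equal m v i - m^2.\<close>
    let ?s = "Quat 0 (qIm1 h + m) (qIm2 h) (qIm3 h)"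
    have "h * ?s = ?s * cq ?\<beta>"
      using m2 by (simp add: cq_def quat_defs algebra_simps)
    moreover have "?s \<noteq> 0"
      using False by (auto simp: zero_quat_def)
    ultimately show ?thesis
      by blast
  qed
  then obtain s where s: "s \<noteq> 0" "h * s = s * cq ?\<beta>"
    by blast
  define c where "c = cq (of_real (1 / sqrt (qnorm2 s)))"
  show thesis
  proof (rule that[of "s * c" ?\<beta>])
    show "qnorm2 (s * c) = 1"
      using s qnorm2_eq_0_iff[of s]
      by (simp add: qnorm2_mult c_def qnorm2_cq norm_divide power_divide)
    show "Im ?\<beta> \<ge> 0"
      using m by simp
    show "h * (s * c) = s * c * cq ?\<beta>"
      using s by (metis c_def cq_of_real_commute mult.assoc)
  qed
qed

subsection \<open>Unitary equivalence and the invariance of the traces\<close>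

lemma ctranspose_mult:
  fixes A :: "quat ^ 'n ^ 'm" and B :: "quat ^ 'k ^ 'n"
  shows "ctranspose (A ** B) = ctranspose B ** ctranspose A"
  by (simp add: ctranspose_def matrix_matrix_mult_def Finite_Cartesian_Product.vec_eq_iff
      qconj_sum qconj_mult)

lemma ctranspose_ctranspose [simp]: "ctranspose (ctranspose A) = A"
  by (simp add: ctranspose_def Finite_Cartesian_Product.vec_eq_iff)

lemma ctranspose_0 [simp]: "ctranspose 0 = 0"
  by (simp add: ctranspose_def Finite_Cartesian_Product.vec_eq_iff)

lemma ctranspose_mat_1 [simp]: "ctranspose (mat 1) = mat 1"
  by (auto simp: ctranspose_def Finite_Cartesian_Product.mat_def Finite_Cartesian_Product.vec_eq_iff)

lemma Tr_add: "Tr (A + B) = Tr A + Tr B"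
  by (simp add: Tr_eq sum.distrib qRe_add)

text \<open>Cyclicity survives noncommutative entries because only real parts are summed.\<close>

lemma Tr_mult_commute:
  fixes A :: "quat ^ 'n ^ 'm" and B :: "quat ^ 'm ^ 'n"
  shows "Tr (A ** B) = Tr (B ** A)"
  unfolding Tr_eq matrix_matrix_mult_def
  by (simp add: qRe_sum) (subst sum.swap, simp add: qRe_mult_commute)

text \<open>The trace is twice the sum of the squared moduli of all entries.\<close>

lemma Tr_ctranspose_mult_self_eq_0:
  assumes "Tr (ctranspose A ** A) = 0"
  shows "A = 0"
proof -
  have "Tr (ctranspose A ** A) = 2 * (\<Sum>i\<in>UNIV. \<Sum>k\<in>UNIV. qnorm2 (A $ k $ i))"
    by (simp add: Tr_eq matrix_matrix_mult_def ctranspose_def qRe_sum qconj_mult_self)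
  with assms have "\<forall>i k. qnorm2 (A $ k $ i) = 0"
    by (simp add: sum_nonneg_eq_0_iff sum_nonneg)
  then show ?thesis
    by (simp add: qnorm2_eq_0_iff Finite_Cartesian_Product.vec_eq_iff)
qed

text \<open>\<open>1 - U ** ctranspose U\<close> is a self-adjoint idempotent of trace \<open>0\<close>.\<close>

lemma Sp_mult_ctranspose:
  fixes U :: "quat ^ 'n ^ 'n"
  assumes "U \<in> Sp"
  shows "U ** ctranspose U = mat 1"
proof -
  define P where "P = U ** ctranspose U"
  define Q where "Q = mat 1 - P"
  have U: "ctranspose U ** U = mat 1"
    using assms by (simp add: Sp_def)
  have PP: "P ** P = P"
    unfolding P_def by (metis U matrix_mul_assoc matrix_mul_rid)
  have Pc: "ctranspose P = P"
    by (simp add: P_def ctranspose_mult)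
  have Qc: "ctranspose Q = Q"
  proof -
    have "qconj (x - y) = qconj x - qconj y" for x y
      by (simp add: quat_defs)
    then have "ctranspose Q = ctranspose (mat 1) - ctranspose P"
      by (simp add: Q_def ctranspose_def Finite_Cartesian_Product.vec_eq_iff)
    then show ?thesis
      by (simp add: Pc Q_def)
  qed
  have "Q + P = mat 1"
    by (simp add: Q_def)
  then have "Q = Q ** Q + Q ** P" "P = P ** Q + P ** P"
    by (metis matrix_add_ldistrib matrix_mul_rid)+
  \<comment> \<open>With \<open>P ** P = P\<close> the second equation gives
    \<open>P ** Q = 0\<close>; the adjoint then gives \<open>Q ** P = 0\<close>, and the first
    equation makes \<open>Q\<close> idempotent.\<close>
  moreover have "Q ** P = ctranspose (P ** Q)"
    by (simp add: ctranspose_mult Pc Qc)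
  ultimately have "ctranspose Q ** Q = Q"
    using PP Qc by simp
  moreover have "Tr Q = 0"
    using Tr_add[of Q P] Tr_mult_commute[of U "ctranspose U"] \<open>Q + P = mat 1\<close>
    by (simp add: P_def U)
  ultimately have "Q = 0"
    by (intro Tr_ctranspose_mult_self_eq_0) simp
  then show ?thesis
    by (simp add: Q_def P_def)
qed

lemma ctranspose_Sp: "U \<in> Sp \<Longrightarrow> ctranspose U \<in> Sp"
  using Sp_mult_ctranspose[of U] by (simp add: Sp_def)

lemma matrix_inv_Sp:
  assumes "U \<in> Sp"
  shows "matrix_inv U = ctranspose U"
proof -
  have U: "ctranspose U ** U = mat 1" "U ** ctranspose U = mat 1"
    using assms Sp_mult_ctranspose by (auto simp: Sp_def)
  \<comment> \<open>\<open>matrix_inv\<close> is a Hilbert choice; \<open>ctranspose U\<close>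
    witnesses that a two-sided inverse exists, and uniqueness of inverses then identifies the
    two.\<close>
  then have "U ** matrix_inv U = mat 1"
    unfolding matrix_inv_def
    by (rule_tac someI2[where a = "ctranspose U"]) auto
  then show ?thesis
    by (metis U(1) matrix_mul_assoc matrix_mul_lid matrix_mul_rid)
qed

lemma Sp_equiv_iff: "Sp_equiv A B \<longleftrightarrow> (\<exists>U\<in>Sp. A = U ** B ** ctranspose U)"
  by (auto simp: Sp_equiv_def matrix_inv_Sp)

lemma Sp_equiv_sym:
  assumes "Sp_equiv A B"
  shows "Sp_equiv B A"
proof -
  obtain U where U: "U \<in> Sp" and A: "A = U ** B ** ctranspose U"
    using assms by (auto simp: Sp_equiv_iff)
  have "B = ctranspose U ** A ** ctranspose (ctranspose U)"
    using U unfolding A Sp_def ctranspose_ctranspose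
    by (metis (mono_tags, lifting) matrix_mul_assoc matrix_mul_lid matrix_mul_rid mem_Collect_eq)
  then show ?thesis
    using ctranspose_Sp[OF U] unfolding Sp_equiv_iff by blast
qed

lemma Sp_equiv_trans:
  assumes "Sp_equiv A B" "Sp_equiv B C"
  shows "Sp_equiv A C"
proof -
  obtain U V where U: "U \<in> Sp" "A = U ** B ** ctranspose U" and V: "V \<in> Sp" "B = V ** C ** ctranspose V"
    using assms by (auto simp: Sp_equiv_iff)
  have "ctranspose (U ** V) ** (U ** V) = ctranspose V ** (ctranspose U ** U) ** V"
    by (simp add: ctranspose_mult matrix_mul_assoc)
  also have "\<dots> = mat 1"
    using U(1) V(1) by (simp add: Sp_def)
  finally have "U ** V \<in> Sp"
    by (simp add: Sp_def)
  moreover have "A = (U ** V) ** C ** ctranspose (U ** V)"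
    by (simp add: U(2) V(2) ctranspose_mult matrix_mul_assoc)
  ultimately show ?thesis
    by (auto simp: Sp_equiv_iff)
qed

lemma Tr_Sp_conj:
  assumes "U \<in> Sp"
  shows "Tr (U ** X ** ctranspose U) = Tr X"
  using assms Tr_mult_commute[of "U ** X" "ctranspose U"] by (simp add: Sp_def matrix_mul_assoc)

lemma Sp_conj_mult:
  assumes "U \<in> Sp"
  shows "(U ** X ** ctranspose U) ** (U ** Y ** ctranspose U) = U ** (X ** Y) ** ctranspose U"
proof -
  have "(U ** X ** ctranspose U) ** (U ** Y ** ctranspose U) =
      U ** X ** (ctranspose U ** U) ** Y ** ctranspose U"
    by (simp only: matrix_mul_assoc)
  also have "\<dots> = U ** X ** Y ** ctranspose U"
    using assms by (simp only: Sp_def mem_Collect_eq matrix_mul_rid)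
  finally show ?thesis
    by (simp only: matrix_mul_assoc)
qed

lemma ctranspose_Sp_conj: "ctranspose (U ** X ** ctranspose U) = U ** ctranspose X ** ctranspose U"
  by (simp add: ctranspose_mult matrix_mul_assoc)

lemma mpow_Sp_conj:
  assumes "U \<in> Sp"
  shows "mpow (U ** X ** ctranspose U) k = U ** mpow X k ** ctranspose U"
  by (induction k) (simp_all add: Sp_mult_ctranspose[OF assms] Sp_conj_mult[OF assms])

text \<open>Conjugation by a unitary matrix commutes with products, powers and adjoints. Exponents k
  = l = 1 and k = l = 2 give the two mixed traces.\<close>

lemma Sp_equiv_invariants:
  assumes "Sp_equiv A B"
  shows "Tr (mpow A k) = Tr (mpow B k)"
    and "Tr (mpow A k ** mpow (ctranspose A) l) = Tr (mpow B k ** mpow (ctranspose B) l)"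
proof -
  obtain U where U: "U \<in> Sp" and A: "A = U ** B ** ctranspose U"
    using assms by (auto simp: Sp_equiv_iff)
  show "Tr (mpow A k) = Tr (mpow B k)"
    and "Tr (mpow A k ** mpow (ctranspose A) l) = Tr (mpow B k ** mpow (ctranspose B) l)"
    unfolding A ctranspose_Sp_conj mpow_Sp_conj[OF U] Sp_conj_mult[OF U] Tr_Sp_conj[OF U] by simp_all
qed

subsection \<open>Two by two matrices\<close>

definition mat2 :: "'a \<Rightarrow> 'a \<Rightarrow> 'a \<Rightarrow> 'a \<Rightarrow> 'a ^ 2 ^ 2" where
  "mat2 a b c d =
    (\<chi> i j. if i = 1 then if j = 1 then a else b else if j = 1 then c else d)"

lemma mat2_cases:
  obtains a b c d where "A = mat2 a b c d"
proof
  show "A = mat2 (A $ 1 $ 1) (A $ 1 $ 2) (A $ 2 $ 1) (A $ 2 $ 2)"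
    by (simp add: mat2_def Finite_Cartesian_Product.vec_eq_iff forall_2)
qed

lemma mat2_eq_iff: "mat2 a b c d = mat2 a' b' c' d' \<longleftrightarrow> a = a' \<and> b = b' \<and> c = c' \<and> d = d'"
  by (auto simp: mat2_def Finite_Cartesian_Product.vec_eq_iff forall_2)

lemma mat2_mult:
  fixes a :: "'a :: semiring_1"
  shows "mat2 a b c d ** mat2 a' b' c' d' =
    mat2 (a * a' + b * c') (a * b' + b * d') (c * a' + d * c') (c * b' + d * d')"
  by (simp add: mat2_def matrix_matrix_mult_def Finite_Cartesian_Product.vec_eq_iff forall_2 sum_2)

lemma mat_1_eq_mat2: "mat 1 = mat2 1 0 0 1"
  by (simp add: mat2_def Finite_Cartesian_Product.mat_def Finite_Cartesian_Product.vec_eq_iff forall_2)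

lemma ctranspose_mat2: "ctranspose (mat2 a b c d) = mat2 (qconj a) (qconj c) (qconj b) (qconj d)"
  by (simp add: mat2_def ctranspose_def Finite_Cartesian_Product.vec_eq_iff forall_2)

lemma Tr_mat2: "Tr (mat2 a b c d) = 2 * (qRe a + qRe d)"
  by (simp add: mat2_def Tr_eq sum_2 qRe_add)

lemma mat2_in_Sp_iff:
  "mat2 a b c d \<in> Sp \<longleftrightarrow> qconj a * a + qconj c * c = 1 \<and> qconj a * b + qconj c * d = 0 \<and>
    qconj b * a + qconj d * c = 0 \<and> qconj b * b + qconj d * d = 1"
  by (simp add: Sp_def ctranspose_mat2 mat2_mult mat_1_eq_mat2 mat2_eq_iff)

text \<open>Conjugation by the diagonal matrix with entries \<open>u\<close>, \<open>v\<close>; it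
  serves to make a diagonal entry complex and, later, to move the corner while fixing the
  diagonal.\<close>

lemma diag_Sp_equiv:
  assumes "qnorm2 u = 1" "qnorm2 v = 1"
  shows "Sp_equiv (mat2 (u * a * qconj u) (u * b * qconj v) (v * c * qconj u) (v * d * qconj v))
    (mat2 a b c d)"
  unfolding Sp_equiv_iff
proof (rule bexI[of _ "mat2 u 0 0 v"])
  show "mat2 u 0 0 v \<in> Sp"
    using assms by (simp add: mat2_in_Sp_iff qnorm2_eq_1_iff)
qed (simp add: ctranspose_mat2 mat2_mult)

section \<open>Unitary triangularization with diagonal in the upper half plane\<close>

lemma unit_vector_in_Sp:
  assumes "qnorm2 x + qnorm2 y = 1"
  obtains z w where "mat2 x z y w \<in> Sp"
proof (cases "x = 0")
  case True
  then have "mat2 x 1 y 0 \<in> Sp"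
    using assms by (simp add: mat2_in_Sp_iff qnorm2_eq_1_iff)
  then show thesis
    by (rule that)
next
  case False
  define r where "r = sqrt (qnorm2 x)"
  have r2: "r * r = qnorm2 x" and r: "r \<noteq> 0"
    using False by (simp_all add: r_def qnorm2_eq_0_iff)
  let ?R = "\<lambda>t. cq (of_real t)"
  have R: "?R (s * t) = ?R s * ?R t" "?R (s + t) = ?R s + ?R t" "qconj (?R t) = ?R t" for s t
    by (simp_all add: cq_def quat_defs)
  have sum1: "?R s + ?R t = 1" if "s + t = 1" for s t
    using that R(2)[of s t] by (simp add: cq_simps(2))
  \<comment> \<open>Gram-Schmidt: subtracting from (0, 1) its component along (x, y) leaves (- x
    \<open>qconj y\<close>, r^2), whose length is r.\<close>
  let ?z = "- (?R (1 / r) * (x * qconj y))" and ?w = "?R r"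
  have 1: "qconj x * x + qconj y * y = 1"
    unfolding qconj_mult_self by (rule sum1[OF assms])
  have 2: "qconj x * ?z + qconj y * ?w = 0"
  proof -
    have "qconj x * ?z = - (?R (1 / r) * (qconj x * x) * qconj y)"
      by (metis cq_of_real_commute mult.assoc mult_minus_right)
    also have "\<dots> = - (?R r * qconj y)"
      unfolding qconj_mult_self R(1)[symmetric] r2[symmetric] using r by simp
    finally show ?thesis
      by (simp add: cq_of_real_commute)
  qed
  have 3: "qconj ?z * x + qconj ?w * y = 0"
    using arg_cong[OF 2, of qconj] by (simp only: qconj_add qconj_mult qconj_qconj qconj_0_1)
  have "qnorm2 ?z = qnorm2 y"
  proof -
    have "qnorm2 (- q) = qnorm2 q" for q
      by (simp add: qnorm2_def quat_defs)
    then show ?thesis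
      using r r2 False qnorm2_eq_0_iff[of x]
      by (simp add: qnorm2_mult qnorm2_cq norm_divide power_divide power2_eq_square)
  qed
  moreover have "qnorm2 ?w = qnorm2 x"
    using r2 by (simp add: qnorm2_cq power2_eq_square)
  ultimately have 4: "qconj ?z * ?z + qconj ?w * ?w = 1"
    unfolding qconj_mult_self using assms by (intro sum1) simp
  show thesis
    using 1 2 3 4 by (intro that[of ?z ?w]) (simp add: mat2_in_Sp_iff)
qed

text \<open>One Schur step: a unitary matrix with first column (x, y) clears the entry below the
  diagonal. Then conjugation by diag(1, s) moves the second diagonal entry into the upper half plane
  without touching \<open>l\<close>.\<close>

lemma Sp_equiv_upper_of_unit_eigenvector:
  assumes eig: "a * x + b * y = x * l" "c * x + d * y = y * l"
    and n: "qnorm2 x + qnorm2 y = 1"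
  obtains q \<beta> where "Im \<beta> \<ge> 0" "Sp_equiv (mat2 a b c d) (mat2 l q 0 (cq \<beta>))"
proof -
  obtain z w where U: "mat2 x z y w \<in> Sp"
    using unit_vector_in_Sp[OF n] .
  define A where "A = mat2 a b c d"
  define U where "U = mat2 x z y w"
  have "U \<in> Sp"
    using U by (simp add: U_def)
  obtain e q g h where C: "ctranspose U ** A ** U = mat2 e q g h"
    by (rule mat2_cases)
  have "mat2 e q g h = ctranspose U ** (A ** U)"
    by (simp add: C matrix_mul_assoc)
  also have "\<dots> = mat2 (qconj x * (x * l) + qconj y * (y * l))
      (qconj x * (a * z + b * w) + qconj y * (c * z + d * w))
      (qconj z * (x * l) + qconj w * (y * l)) (qconj z * (a * z + b * w) + qconj w * (c * z + d * w))"
    by (simp add: A_def U_def ctranspose_mat2 mat2_mult eig)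
  finally have "e = (qconj x * x + qconj y * y) * l" "g = (qconj z * x + qconj w * y) * l"
    by (simp_all add: mat2_eq_iff distrib_right mult.assoc)
  then have eg: "e = l" "g = 0"
    using U by (simp_all add: mat2_in_Sp_iff)
  have "mat2 l q 0 h = ctranspose U ** A ** ctranspose (ctranspose U)"
    using C eg by simp
  then have "Sp_equiv (mat2 l q 0 h) A"
    unfolding Sp_equiv_iff by (rule bexI[OF _ ctranspose_Sp[OF \<open>U \<in> Sp\<close>]])
  then have 1: "Sp_equiv A (mat2 l q 0 h)"
    by (rule Sp_equiv_sym)
  obtain s \<beta> where s: "qnorm2 s = 1" "Im \<beta> \<ge> 0" "h * s = s * cq \<beta>"
    by (rule quat_conjugate_complex)
  have ss: "s * qconj s = 1"
    using s(1) qnorm2_eq_1_iff' by blast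
  have qs: "q * s * qconj s = q"
    by (simp add: mult.assoc ss)
  have "h * s * qconj s = h"
    by (simp add: mult.assoc ss)
  then have hs: "s * cq \<beta> * qconj s = h"
    by (simp only: s(3))
  have "Sp_equiv (mat2 l q 0 h) (mat2 l (q * s) 0 (cq \<beta>))"
    using diag_Sp_equiv[of 1 s l "q * s" 0 "cq \<beta>"] s(1) by (simp add: hs qs)
  from Sp_equiv_trans[OF 1 this] show thesis
    unfolding A_def by (rule that[OF s(2)])
qed

text \<open>One row of a right eigenvalue equation: scaling the vector by \<open>r\<close> on the
  right conjugates the eigenvalue. It is applied with \<open>r\<close> real to normalize, and with
  \<open>r\<close> = j to replace a complex eigenvalue by its conjugate.\<close>

lemma right_eigenvector_scale:
  fixes a :: quat
  assumes "a * x + b * y = t * l" "l * r = r * m"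
  shows "a * (x * r) + b * (y * r) = (t * r) * m"
proof -
  have "a * (x * r) + b * (y * r) = (a * x + b * y) * r"
    by (simp add: distrib_right mult.assoc)
  also have "\<dots> = t * (l * r)"
    by (simp add: assms(1) mult.assoc)
  finally show ?thesis
    by (simp add: assms(2) mult.assoc)
qed

lemma Sp_equiv_upper_of_eigenvector:
  assumes eig: "a * x + b * y = x * l" "c * x + d * y = y * l"
    and nz: "x \<noteq> 0 \<or> y \<noteq> 0"
  obtains q \<beta> where "Im \<beta> \<ge> 0" "Sp_equiv (mat2 a b c d) (mat2 l q 0 (cq \<beta>))"
proof -
  define n where "n = qnorm2 x + qnorm2 y"
  have n: "n > 0"
    using nz qnorm2_eq_0_iff[of x] qnorm2_eq_0_iff[of y] qnorm2_nonneg[of x] qnorm2_nonneg[of y]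
    unfolding n_def by linarith
  let ?r = "cq (of_real (1 / sqrt n))"
  have "l * ?r = ?r * l"
    by (rule cq_of_real_commute)
  note eig' = eig(1)[THEN right_eigenvector_scale, OF this] eig(2)[THEN right_eigenvector_scale, OF this]
  have scale: "qnorm2 (t * ?r) = qnorm2 t / n" for t
    using n by (simp add: qnorm2_mult qnorm2_cq norm_divide power_divide)
  have "qnorm2 (x * ?r) + qnorm2 (y * ?r) = 1"
    unfolding scale add_divide_distrib[symmetric] n_def[symmetric] using n by simp
  then obtain q \<beta> where "Im \<beta> \<ge> 0" "Sp_equiv (mat2 a b c d) (mat2 l q 0 (cq \<beta>))"
    by (rule Sp_equiv_upper_of_unit_eigenvector[OF eig'])
  then show thesis
    by (rule that)
qed

text \<open>With \<open>x = cq z + qJ * cq w\<close>, left multiplication by a quaternion is complex linear for the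
  right multiplication by complex numbers.\<close>

lemma quat_eigenvector_exists:
  obtains \<alpha> x y where "x \<noteq> 0 \<or> y \<noteq> 0" "Im \<alpha> \<ge> 0"
    "a * x + b * y = x * cq \<alpha>" "c * x + d * y = y * cq \<alpha>"
proof -
  define p where "p q = Complex (qRe q) (qIm1 q)" for q
  \<comment> \<open>The sign comes from writing j on the left: j i = - k, so q = p + j s.\<close>
  define s where "s q = Complex (qIm2 q) (- qIm3 q)" for q
  \<comment> \<open>Each entry q contributes the 2 by 2 complex matrix of left multiplication by q
    in the basis 1, j.\<close>
  define m where "m i j =
    [[p a, - cnj (s a), p b, - cnj (s b)], [s a, cnj (p a), s b, cnj (p b)],
     [p c, - cnj (s c), p d, - cnj (s d)], [s c, cnj (p c), s d, cnj (p d)]] ! i ! j" for i j :: nat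
  obtain k v where nz: "\<exists>i<4. v i \<noteq> 0"
    and ev: "\<And>i. i < 4 \<Longrightarrow> (\<Sum>j<4. m i j * v j) = k * v i"
    using complex_eigenvector_exists[of 4 m] by auto
  have sum4: "(\<Sum>j<4. f j) = f 0 + f 1 + f 2 + f 3" for f :: "nat \<Rightarrow> complex"
    by (simp add: eval_nat_numeral)
  have ev': "p a * v 0 - cnj (s a) * v 1 + p b * v 2 - cnj (s b) * v 3 = k * v 0"
    "s a * v 0 + cnj (p a) * v 1 + s b * v 2 + cnj (p b) * v 3 = k * v 1"
    "p c * v 0 - cnj (s c) * v 1 + p d * v 2 - cnj (s d) * v 3 = k * v 2"
    "s c * v 0 + cnj (p c) * v 1 + s d * v 2 + cnj (p d) * v 3 = k * v 3"
    using ev[of 0] ev[of 1] ev[of 2] ev[of 3] by (simp_all add: sum4 m_def eval_nat_numeral)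
  define X where "X z w = cq z + qJ * cq w" for z w
  have X_mult: "X z w * cq k = X (k * z) (k * w)" for z w k
    by (simp add: X_def cq_def qJ_def quat_defs algebra_simps)
  have X_add: "X z w + X z' w' = X (z + z') (w + w')" for z w z' w'
    by (simp add: X_def cq_def qJ_def quat_defs)
  have mult_X: "q * X z w = X (p q * z - cnj (s q) * w) (s q * z + cnj (p q) * w)" for q z w
    by (simp add: X_def p_def s_def cq_def qJ_def quat_defs algebra_simps)
  have X_0: "X z w = 0 \<longleftrightarrow> z = 0 \<and> w = 0" for z w
    by (auto simp: X_def cq_def qJ_def quat_defs complex_eq_iff)
  let ?x = "X (v 0) (v 1)" and ?y = "X (v 2) (v 3)"
  have xy: "?x \<noteq> 0 \<or> ?y \<noteq> 0"
  proof -
    have "i < 4 \<Longrightarrow> i = 0 \<or> i = 1 \<or> i = 2 \<or> i = 3" for i :: nat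
      by linarith
    then show ?thesis
      using nz unfolding X_0 by blast
  qed
  have eq: "a * ?x + b * ?y = ?x * cq k" "c * ?x + d * ?y = ?y * cq k"
    using ev' by (simp_all add: X_mult mult_X X_add algebra_simps)
  show thesis
  proof (cases "Im k \<ge> 0")
    case True
    then show thesis
      using that xy eq by blast
  next
    case False
    have "a * (?x * qJ) + b * (?y * qJ) = (?x * qJ) * cq (cnj k)"
      "c * (?x * qJ) + d * (?y * qJ) = (?y * qJ) * cq (cnj k)"
      using eq[THEN right_eigenvector_scale, OF cq_qJ] by simp_all
    moreover have "?x * qJ \<noteq> 0 \<or> ?y * qJ \<noteq> 0"
    proof -
      have "qJ \<noteq> 0"
        by (simp add: qJ_def zero_quat_def)
      then show ?thesis
        using xy by simp
    qed
    ultimately show thesis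
      using that[of "?x * qJ" "?y * qJ" "cnj k"] False by simp
  qed
qed

lemma Sp_equiv_upper:
  obtains \<alpha> q \<beta> where "Im \<alpha> \<ge> 0" "Im \<beta> \<ge> 0" "Sp_equiv A (mat2 (cq \<alpha>) q 0 (cq \<beta>))"
proof -
  obtain a b c d where A: "A = mat2 a b c d"
    by (rule mat2_cases)
  obtain \<alpha> x y where nz: "x \<noteq> 0 \<or> y \<noteq> 0" and \<alpha>: "Im \<alpha> \<ge> 0"
    and eig: "a * x + b * y = x * cq \<alpha>" "c * x + d * y = y * cq \<alpha>"
    by (rule quat_eigenvector_exists)
  obtain q \<beta> where "Im \<beta> \<ge> 0" "Sp_equiv (mat2 a b c d) (mat2 (cq \<alpha>) q 0 (cq \<beta>))"
    using Sp_equiv_upper_of_eigenvector[OF eig nz] .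
  then show thesis
    using that[OF \<alpha>] A by blast
qed

text \<open>The eigenvector for \<open>\<beta>\<close> is \<open>(x, 1)\<close> with \<open>x \<beta> - \<alpha> x = q\<close>; this equation is diagonal in
  the coordinates \<open>x = cq z' + cq w' * qJ\<close>.\<close>

lemma Sp_equiv_swap:
  assumes "Im \<alpha> \<ge> 0" "Im \<beta> \<ge> 0" "\<alpha> \<noteq> \<beta>"
  obtains q' \<gamma> where "Im \<gamma> \<ge> 0"
    "Sp_equiv (mat2 (cq \<alpha>) q 0 (cq \<beta>)) (mat2 (cq \<beta>) q' 0 (cq \<gamma>))"
proof -
  obtain z w where q: "q = cq z + cq w * qJ"
    by (rule quat_complex_decomp)
  \<comment> \<open>The second inequality uses the half plane: \<open>cnj \<beta> = \<alpha>\<close>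
    would force both to be real and hence equal.\<close>
  have ne: "\<beta> - \<alpha> \<noteq> 0" "cnj \<beta> - \<alpha> \<noteq> 0"
    using assms by (auto simp: complex_eq_iff)
  define z' w' where "z' = z / (\<beta> - \<alpha>)" and "w' = w / (cnj \<beta> - \<alpha>)"
  have zw: "z = (\<beta> - \<alpha>) * z'" "w = (cnj \<beta> - \<alpha>) * w'"
    using ne by (simp_all add: z'_def w'_def)
  have "cq \<alpha> * (cq z' + cq w' * qJ) + q * 1 = (cq z' + cq w' * qJ) * cq \<beta>"
    unfolding q zw by (simp add: cq_def qJ_def quat_defs algebra_simps)
  moreover have "0 * (cq z' + cq w' * qJ) + cq \<beta> * 1 = 1 * cq \<beta>"
    by simp
  moreover have "cq z' + cq w' * qJ \<noteq> 0 \<or> (1 :: quat) \<noteq> 0"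
    by simp
  ultimately show thesis
    using that by (rule Sp_equiv_upper_of_eigenvector)
qed

subsection \<open>Invariants of upper triangular matrices\<close>

lemma mpow_upper:
  obtains q' where "mpow (mat2 (cq \<alpha>) q 0 (cq \<beta>)) k = mat2 (cq (\<alpha> ^ k)) q' 0 (cq (\<beta> ^ k))"
proof -
  have "\<exists>q'. mpow (mat2 (cq \<alpha>) q 0 (cq \<beta>)) k = mat2 (cq (\<alpha> ^ k)) q' 0 (cq (\<beta> ^ k))"
    by (induction k) (auto simp: mat_1_eq_mat2 mat2_mult cq_simps)
  then show thesis
    using that by blast
qed

lemma Tr_mpow_upper: "Tr (mpow (mat2 (cq \<alpha>) q 0 (cq \<beta>)) k) = 2 * Re (\<alpha> ^ k + \<beta> ^ k)"
  by (rule mpow_upper[of \<alpha> q \<beta> k]) (simp add: Tr_mat2)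

lemma Tr_mult_ctranspose_mat2:
  "Tr (mat2 a b c d ** ctranspose (mat2 a b c d)) = 2 * (qnorm2 a + qnorm2 b + qnorm2 c + qnorm2 d)"
  by (simp add: ctranspose_mat2 mat2_mult Tr_mat2 mult_qconj_self qRe_add)

lemma mpow_2: "mpow A 2 = A ** A"
  and mpow_3: "mpow A 3 = A ** (A ** A)"
  and mpow_4: "mpow A 4 = A ** (A ** (A ** A))"
  by (simp_all add: eval_nat_numeral)

text \<open>Presents the sixth invariant as the trace of M times its adjoint with M the square of A,
  thus as twice the sum of squared moduli of the entries of M when A is 2 by 2.\<close>

lemma mpow_2_ctranspose: "mpow (ctranspose A) 2 = ctranspose (mpow A 2)"
  by (simp add: mpow_2 ctranspose_mult)

section \<open>Power sums and the diagonal\<close>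

lemma newton_identities_4:
  fixes a b c d :: "'a::comm_ring_1"
  defines "e1 \<equiv> a + b + c + d" and "e2 \<equiv> a*b + a*c + a*d + b*c + b*d + c*d"
    and "e3 \<equiv> a*b*c + a*b*d + a*c*d + b*c*d" and "e4 \<equiv> a*b*c*d"
  shows "a^2+b^2+c^2+d^2 = e1^2 - 2 * e2"
   and "a^3+b^3+c^3+d^3 = e1^3 - 3 * e1 * e2 + 3 * e3"
   and "a^4+b^4+c^4+d^4 = e1^4 - 4 * e1^2 * e2 + 2 * e2^2 + 4 * e1 * e3 - 4 * e4"
   and "(t - a) * (t - b) * (t - c) * (t - d) = t^4 - e1 * t^3 + e2 * t^2 - e3 * t + e4"
  unfolding assms by (simp_all add: algebra_simps power2_eq_square power3_eq_cube power4_eq_xxxx)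
text \<open>Equal power sums give equal elementary symmetric polynomials, hence the same monic
  quartic; evaluate it at \<open>x1\<close>. Matching a single root is enough for the
  application.\<close>

lemma power_sums_determine_roots:
  fixes x1 :: complex
  assumes p: "x1 + x2 + x3 + x4 = y1 + y2 + y3 + y4"
    "x1^2 + x2^2 + x3^2 + x4^2 = y1^2 + y2^2 + y3^2 + y4^2"
    "x1^3 + x2^3 + x3^3 + x4^3 = y1^3 + y2^3 + y3^3 + y4^3"
    "x1^4 + x2^4 + x3^4 + x4^4 = y1^4 + y2^4 + y3^4 + y4^4"
  shows "x1 = y1 \<or> x1 = y2 \<or> x1 = y3 \<or> x1 = y4"
proof -
  note nx = newton_identities_4[of x1 x2 x3 x4] and ny = newton_identities_4[of y1 y2 y3 y4]
  have e2: "x1*x2 + x1*x3 + x1*x4 + x2*x3 + x2*x4 + x3*x4 = y1*y2 + y1*y3 + y1*y4 + y2*y3 + y2*y4 + y3*y4"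
    using p(2) unfolding nx(1) ny(1) p(1) by (simp del: distrib_left_numeral)
  have e3: "x1*x2*x3 + x1*x2*x4 + x1*x3*x4 + x2*x3*x4 = y1*y2*y3 + y1*y2*y4 + y1*y3*y4 + y2*y3*y4"
    using p(3) unfolding nx(2) ny(2) p(1) e2 by (simp del: distrib_left_numeral)
  have e4: "x1*x2*x3*x4 = y1*y2*y3*y4"
    using p(4) unfolding nx(3) ny(3) p(1) e2 e3 by (simp del: distrib_left_numeral)
  have "(x1 - y1) * (x1 - y2) * (x1 - y3) * (x1 - y4) = (x1 - x1) * (x1 - x2) * (x1 - x3) * (x1 - x4)"
    by (simp only: newton_identities_4(4)[of x1] p(1) e2 e3 e4)
  then show ?thesis
    by simp
qed

text \<open>Twice the real parts are the power sums of the four numbers \<alpha>, \<beta> and their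
  conjugates. This locates \<alpha>; cancelling it leaves Re \<beta> and Re \<beta>^2, which fix
  \<beta> in the half plane.\<close>

lemma upper_half_plane_power_sums:
  assumes Im: "Im \<alpha> \<ge> 0" "Im \<beta> \<ge> 0" "Im \<alpha>' \<ge> 0" "Im \<beta>' \<ge> 0"
    and p: "\<And>k. k \<in> {1, 2, 3, 4 :: nat} \<Longrightarrow> Re (\<alpha> ^ k + \<beta> ^ k) = Re (\<alpha>' ^ k + \<beta>' ^ k)"
  shows "\<alpha> = \<alpha>' \<and> \<beta> = \<beta>' \<or> \<alpha> = \<beta>' \<and> \<beta> = \<alpha>'"
proof -
  have ps: "\<alpha> ^ k + cnj \<alpha> ^ k + \<beta> ^ k + cnj \<beta> ^ k = \<alpha>' ^ k + cnj \<alpha>' ^ k + \<beta>' ^ k + cnj \<beta>' ^ k"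
    if "k \<in> {1, 2, 3, 4}" for k :: nat
    using p[OF that] by (simp add: complex_eq_iff flip: complex_cnj_power)
  have "\<alpha> = \<alpha>' \<or> \<alpha> = cnj \<alpha>' \<or> \<alpha> = \<beta>' \<or> \<alpha> = cnj \<beta>'"
    using ps[of 1] ps[of 2] ps[of 3] ps[of 4] by (intro power_sums_determine_roots) simp_all
  then have \<alpha>: "\<alpha> = \<alpha>' \<or> \<alpha> = \<beta>'"
    using Im by (auto simp: complex_eq_iff)
  have eq: "x = y" if "Im x \<ge> 0" "Im y \<ge> 0" "Re x = Re y" "Re (x^2) = Re (y^2)" for x y
  proof -
    have "(Im x)\<^sup>2 = (Im y)\<^sup>2"
      using that by (simp add: power2_eq_square)
    then show ?thesis
      using that by (simp add: complex_eq_iff)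
  qed
  from \<alpha> show ?thesis
  proof
    assume "\<alpha> = \<alpha>'"
    then show ?thesis
      using p[of 1] p[of 2] eq[of \<beta> \<beta>'] Im by simp
  next
    assume "\<alpha> = \<beta>'"
    then show ?thesis
      using p[of 1] p[of 2] eq[of \<beta> \<alpha>'] Im by simp
  qed
qed

section \<open>The corner entry up to diagonal conjugation\<close>

lemma unit_multiple:
  assumes "cmod z = cmod z'"
  obtains \<zeta> where "cmod \<zeta> = 1" "z = \<zeta> * z'"
proof (cases "z' = 0")
  case True
  then show thesis
    using assms that[of 1] by simp
next
  case False
  then show thesis
    using assms that[of "z / z'"] by (simp add: norm_divide)
qed

text \<open>Pairs of unit quaternions centralizing \<alpha> and \<beta> act on the corner; the two
  quantities assumed equal separate the orbits. The second is the squared modulus of the corner of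
  the squared matrix.\<close>

lemma twisted_orbit:
  assumes Im: "Im \<alpha> \<ge> 0" "Im \<beta> \<ge> 0"
    and n: "qnorm2 q = qnorm2 q'" "qnorm2 (cq \<alpha> * q + q * cq \<beta>) = qnorm2 (cq \<alpha> * q' + q' * cq \<beta>)"
  obtains u v where "qnorm2 u = 1" "qnorm2 v = 1" "cq \<alpha> * u = u * cq \<alpha>" "cq \<beta> * v = v * cq \<beta>"
    "q = u * q' * qconj v"
proof (cases "q' = 0")
  case True
  then have "q = 0"
    using n by (simp add: qnorm2_eq_0_iff)
  then show thesis
    using True that[of 1 1] by simp
next
  case q': False
  have "qnorm2 (q * inverse q') * qnorm2 q' = qnorm2 q" "qnorm2 q' * qnorm2 (inverse q' * q) = qnorm2 q"
    using q' by (simp_all flip: qnorm2_mult add: mult.assoc) (simp flip: mult.assoc)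
  then have n1: "qnorm2 (q * inverse q') = 1" "qnorm2 (inverse q' * q) = 1"
    using q' n by (simp_all add: qnorm2_eq_0_iff)
  consider "Im \<alpha> = 0" | "Im \<beta> = 0" | "Im \<alpha> > 0" "Im \<beta> > 0"
    using Im by fastforce
  then show thesis
  proof cases
    case 1
    then have "\<alpha> = of_real (Re \<alpha>)"
      by (simp add: complex_eq_iff)
    then have "cq \<alpha> * u = u * cq \<alpha>" for u
      using cq_of_real_commute by metis
    moreover have "q = q * inverse q' * q' * qconj 1"
      using q' by (simp add: mult.assoc)
    ultimately show thesis
      using n1 by (intro that[of "q * inverse q'" 1]) simp_all
  next
    case 2
    then have "\<beta> = of_real (Re \<beta>)"
      by (simp add: complex_eq_iff)
    then have "cq \<beta> * v = v * cq \<beta>" for v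
      using cq_of_real_commute by metis
    moreover have "q = 1 * q' * qconj (qconj (inverse q' * q))"
      using q' by (simp flip: mult.assoc)
    ultimately show thesis
      using n1 by (intro that[of 1 "qconj (inverse q' * q)"]) simp_all
  next
    case 3
    obtain z w where q: "q = cq z + cq w * qJ"
      by (rule quat_complex_decomp)
    obtain z' w' where q': "q' = cq z' + cq w' * qJ"
      by (rule quat_complex_decomp)
    have twist: "cq \<alpha> * (cq z + cq w * qJ) + (cq z + cq w * qJ) * cq \<beta> =
        cq ((\<alpha> + \<beta>) * z) + cq ((\<alpha> + cnj \<beta>) * w) * qJ" for z w
      by (simp add: cq_def qJ_def quat_defs algebra_simps)
    have e1: "(cmod z)\<^sup>2 + (cmod w)\<^sup>2 = (cmod z')\<^sup>2 + (cmod w')\<^sup>2"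
      using n(1) by (simp add: q q' qnorm2_complex_decomp)
    have e2: "(cmod (\<alpha> + \<beta>))\<^sup>2 * (cmod z)\<^sup>2 + (cmod (\<alpha> + cnj \<beta>))\<^sup>2 * (cmod w)\<^sup>2 =
        (cmod (\<alpha> + \<beta>))\<^sup>2 * (cmod z')\<^sup>2 + (cmod (\<alpha> + cnj \<beta>))\<^sup>2 * (cmod w')\<^sup>2"
      using n(2) by (simp add: q q' twist qnorm2_complex_decomp norm_mult power_mult_distrib)
    \<comment> \<open>The two coefficients in \<open>e2\<close> differ by a positive number, so
      \<open>e1\<close> and \<open>e2\<close> form a nonsingular linear system for the squared
      moduli.\<close>
    have e3: "(cmod (\<alpha> + \<beta>))\<^sup>2 = (cmod (\<alpha> + cnj \<beta>))\<^sup>2 + 4 * (Im \<alpha> * Im \<beta>)"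
      unfolding cmod_power2 by (simp add: power2_eq_square algebra_simps)
    have "4 * (Im \<alpha> * Im \<beta>) * (cmod z)\<^sup>2 = 4 * (Im \<alpha> * Im \<beta>) * (cmod z')\<^sup>2"
      using arg_cong[OF e1, of "(*) ((cmod (\<alpha> + cnj \<beta>))\<^sup>2)"] e2 unfolding e3
      by (simp only: distrib_left distrib_right)
    then have "(cmod z)\<^sup>2 = (cmod z')\<^sup>2"
      using 3 by simp
    with e1 have zw: "cmod z = cmod z'" "cmod w = cmod w'"
      by simp_all
    obtain \<zeta> where \<zeta>: "cmod \<zeta> = 1" "z = \<zeta> * z'"
      using unit_multiple[OF zw(1)] .
    obtain \<omega> where \<omega>: "cmod \<omega> = 1" "w = \<omega> * w'"
      using unit_multiple[OF zw(2)] .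
    \<comment> \<open>Moving v past j conjugates it, so the action multiplies z' by u
      \<open>cnj v\<close> and w' by u v. These must be \<zeta> and \<omega>, whence u^2 = \<zeta>
      \<omega> and v = \<omega> \<open>cnj u\<close>.\<close>
    define u where "u = csqrt (\<zeta> * \<omega>)"
    define v where "v = \<omega> * cnj u"
    have u2: "u * u = \<zeta> * \<omega>"
      by (simp add: u_def flip: power2_eq_square)
    have "cmod u = 1"
      using \<zeta> \<omega> by (simp add: u_def norm_mult)
    then have unit: "u * cnj u = 1" "\<omega> * cnj \<omega> = 1" "cmod v = 1"
      using \<omega> by (simp_all add: complex_norm_square[symmetric] v_def norm_mult)
    have "u * cnj v = (u * u) * cnj \<omega>" "u * v = \<omega> * (u * cnj u)"
      by (simp_all add: v_def)
    then have uv: "u * cnj v = \<zeta>" "u * v = \<omega>"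
      using unit by (simp_all add: u2 mult.assoc)
    have "cq u * q' * qconj (cq v) = cq (u * cnj v * z') + cq (u * v * w') * qJ"
      unfolding q' by (simp add: cq_def qJ_def quat_defs algebra_simps)
    then have "q = cq u * q' * qconj (cq v)"
      by (simp add: uv q \<zeta> \<omega>)
    moreover have "cq \<alpha> * cq u = cq u * cq \<alpha>" "cq \<beta> * cq v = cq v * cq \<beta>"
      by (metis cq_simps(4) mult.commute)+
    ultimately show thesis
      using that[of "cq u" "cq v"] \<open>cmod u = 1\<close> unit by (simp add: qnorm2_cq)
  qed
qed

lemma Sp_equiv_upper_same_diag:
  assumes Im: "Im \<alpha> \<ge> 0" "Im \<beta> \<ge> 0"
    and n: "qnorm2 q = qnorm2 q'" "qnorm2 (cq \<alpha> * q + q * cq \<beta>) = qnorm2 (cq \<alpha> * q' + q' * cq \<beta>)"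
  shows "Sp_equiv (mat2 (cq \<alpha>) q 0 (cq \<beta>)) (mat2 (cq \<alpha>) q' 0 (cq \<beta>))"
proof -
  obtain u v where uv: "qnorm2 u = 1" "qnorm2 v = 1" "cq \<alpha> * u = u * cq \<alpha>" "cq \<beta> * v = v * cq \<beta>"
    "q = u * q' * qconj v"
    by (rule twisted_orbit[OF Im n])
  have "u * cq \<alpha> * qconj u = cq \<alpha>" "v * cq \<beta> * qconj v = cq \<beta>"
    using uv by (metis mult.assoc mult_1_right qnorm2_eq_1_iff')+
  then show ?thesis
    using diag_Sp_equiv[OF uv(1,2), of "cq \<alpha>" q' 0 "cq \<beta>"] uv(5) by simp
qed

section \<open>Completeness of the six invariants\<close>

definition same_invariants :: "quat ^ 2 ^ 2 \<Rightarrow> quat ^ 2 ^ 2 \<Rightarrow> bool" where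
  "same_invariants A B \<longleftrightarrow> (\<forall>i \<in> {1, 2, 3, 4 :: nat}. Tr (mpow A i) = Tr (mpow B i)) \<and>
    Tr (A ** ctranspose A) = Tr (B ** ctranspose B) \<and>
    Tr (mpow A 2 ** mpow (ctranspose A) 2) = Tr (mpow B 2 ** mpow (ctranspose B) 2)"

lemma same_invariants_if_Sp_equiv: "Sp_equiv A B \<Longrightarrow> same_invariants A B"
  using Sp_equiv_invariants[of A B] Sp_equiv_invariants(2)[of A B 1 1]
  by (simp add: same_invariants_def)

lemma same_invariants_trans: "same_invariants A B \<Longrightarrow> same_invariants B C \<Longrightarrow> same_invariants A C"
  by (simp add: same_invariants_def)

lemma same_invariants_upper_diag:
  assumes "Im \<alpha> \<ge> 0" "Im \<beta> \<ge> 0" "Im \<alpha>' \<ge> 0" "Im \<beta>' \<ge> 0"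
    and "same_invariants (mat2 (cq \<alpha>) q 0 (cq \<beta>)) (mat2 (cq \<alpha>') q' 0 (cq \<beta>'))"
  shows "\<alpha> = \<alpha>' \<and> \<beta> = \<beta>' \<or> \<alpha> = \<beta>' \<and> \<beta> = \<alpha>'"
proof (rule upper_half_plane_power_sums[OF assms(1-4)])
  fix k :: nat
  assume "k \<in> {1, 2, 3, 4}"
  then have "Tr (mpow (mat2 (cq \<alpha>) q 0 (cq \<beta>)) k) = Tr (mpow (mat2 (cq \<alpha>') q' 0 (cq \<beta>')) k)"
    using assms(5) by (simp only: same_invariants_def)
  then show "Re (\<alpha> ^ k + \<beta> ^ k) = Re (\<alpha>' ^ k + \<beta>' ^ k)"
    by (simp add: Tr_mpow_upper)
qed

text \<open>With equal diagonals, equality of the mixed traces reduces to equality of the squared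
  moduli of the corners, for the matrices and for their squares.\<close>

lemma same_invariants_upper_same_diag:
  assumes Im: "Im \<alpha> \<ge> 0" "Im \<beta> \<ge> 0"
    and same: "same_invariants (mat2 (cq \<alpha>) q 0 (cq \<beta>)) (mat2 (cq \<alpha>) q' 0 (cq \<beta>))"
  shows "Sp_equiv (mat2 (cq \<alpha>) q 0 (cq \<beta>)) (mat2 (cq \<alpha>) q' 0 (cq \<beta>))"
proof (rule Sp_equiv_upper_same_diag[OF Im])
  let ?T = "\<lambda>q. mat2 (cq \<alpha>) q 0 (cq \<beta>)"
  show "qnorm2 q = qnorm2 q'"
    using same by (simp add: same_invariants_def Tr_mult_ctranspose_mat2)
  have "Tr (mpow (?T q) 2 ** ctranspose (mpow (?T q) 2)) = Tr (mpow (?T q') 2 ** ctranspose (mpow (?T q') 2))"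
    using same by (simp only: same_invariants_def mpow_2_ctranspose)
  then show "qnorm2 (cq \<alpha> * q + q * cq \<beta>) = qnorm2 (cq \<alpha> * q' + q' * cq \<beta>)"
    by (simp add: mpow_2 mat2_mult Tr_mult_ctranspose_mat2)
qed

lemma Sp_equiv_if_same_invariants:
  assumes "same_invariants A B"
  shows "Sp_equiv A B"
proof -
  obtain \<alpha> q \<beta> where A: "Im \<alpha> \<ge> 0" "Im \<beta> \<ge> 0" "Sp_equiv A (mat2 (cq \<alpha>) q 0 (cq \<beta>))"
    by (rule Sp_equiv_upper)
  obtain \<alpha>' q' \<beta>' where B: "Im \<alpha>' \<ge> 0" "Im \<beta>' \<ge> 0" "Sp_equiv B (mat2 (cq \<alpha>') q' 0 (cq \<beta>'))"
    by (rule Sp_equiv_upper)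
  have same: "same_invariants (mat2 (cq \<alpha>) q 0 (cq \<beta>)) C" if "Sp_equiv B C" for C
    using assms A(3) that Sp_equiv_sym same_invariants_if_Sp_equiv same_invariants_trans by metis
  have "\<exists>q''. Sp_equiv B (mat2 (cq \<alpha>) q'' 0 (cq \<beta>))"
  proof (cases "\<alpha> = \<alpha>' \<and> \<beta> = \<beta>'")
    case True
    then show ?thesis
      using B by blast
  next
    case False
    \<comment> \<open>If \<open>\<alpha>'\<close> and \<open>\<beta>'\<close> were equal, the two
      possible orders of the diagonal would coincide.\<close>
    then have swap: "\<alpha> = \<beta>'" "\<beta> = \<alpha>'" and "\<alpha>' \<noteq> \<beta>'"
      using same_invariants_upper_diag[OF A(1,2) B(1,2) same[OF B(3)]] by auto
    obtain q'' \<gamma> where \<gamma>: "Im \<gamma> \<ge> 0"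
      "Sp_equiv (mat2 (cq \<alpha>') q' 0 (cq \<beta>')) (mat2 (cq \<beta>') q'' 0 (cq \<gamma>))"
      using Sp_equiv_swap[OF B(1,2) \<open>\<alpha>' \<noteq> \<beta>'\<close>] .
    then have B': "Sp_equiv B (mat2 (cq \<alpha>) q'' 0 (cq \<gamma>))"
      using B(3) Sp_equiv_trans swap by blast
    \<comment> \<open>The exchange leaves the second diagonal entry unspecified; comparing diagonals
      once more determines it.\<close>
    then have "\<gamma> = \<beta>"
      using same_invariants_upper_diag[OF A(1,2) A(1) \<gamma>(1) same[OF B']] by auto
    then show ?thesis
      using B' by blast
  qed
  then obtain q'' where "Sp_equiv B (mat2 (cq \<alpha>) q'' 0 (cq \<beta>))"
    by blast
  then show ?thesis
    using same_invariants_upper_same_diag[OF A(1,2) same] A(3) Sp_equiv_trans Sp_equiv_sym by metis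
qed

subsection \<open>Minimality\<close>

lemma Sp_equiv_six_invariants:
  assumes "Sp_equiv A B" "f \<in> six_invariants"
  shows "f A = f B"
  using same_invariants_if_Sp_equiv[OF assms(1)] assms(2)
  by (auto simp: same_invariants_def six_invariants_def eval_nat_numeral)

text \<open>A pair on which only \<open>f\<close> differs cannot be equivalent, as \<open>f\<close>
  is invariant, yet every member of \<open>F\<close> agrees on it.\<close>

lemma not_separates_if_missing:
  assumes "f \<in> six_invariants" "f \<notin> F" "F \<subseteq> six_invariants"
    and "f A \<noteq> f B" "\<And>g. g \<in> six_invariants \<Longrightarrow> g \<noteq> f \<Longrightarrow> g A = g B"
  shows "\<not> separates_Sp_classes F"
  using assms Sp_equiv_six_invariants[of A B f] unfolding separates_Sp_classes_def by blast

lemma six_invariants_minimal: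
  assumes "F \<subset> six_invariants"
  shows "\<not> separates_Sp_classes F"
proof -
  let ?D = "\<lambda>z w. mat2 (cq z) 0 0 (cq w)"
  obtain f where f: "f \<in> six_invariants" "f \<notin> F"
    using assms by blast
  have F: "F \<subseteq> six_invariants"
    using assms by blast
  note ns = not_separates_if_missing[OF f F]
  note calc = six_invariants_def mpow_2 mpow_3 mpow_4 mat2_mult ctranspose_mat2 Tr_mat2 cq_def qJ_def quat_defs
  from f(1) consider "f = (\<lambda>A. Tr A)" | "f = (\<lambda>A. Tr (mpow A 2))" | "f = (\<lambda>A. Tr (mpow A 3))"
    | "f = (\<lambda>A. Tr (mpow A 4))" | "f = (\<lambda>A. Tr (A ** ctranspose A))"
    | "f = (\<lambda>A. Tr (mpow A 2 ** mpow (ctranspose A) 2))"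
    unfolding six_invariants_def by blast
  then show ?thesis
  proof cases
    case 1
    show ?thesis
      \<comment> \<open>The second matrix is the negative of the first, so only odd traces can
        change; Re (2 + i)^3 = 2 and Re (1 + i)^3 = -2 cancel, while the trace is nonzero.\<close>
      by (rule ns[of "?D (Complex 2 1) (Complex 1 1)" "?D (Complex (-2) (-1)) (Complex (-1) (-1))"])
        (auto simp: 1 calc)
  next
    case 2
    show ?thesis
      \<comment> \<open>The squares are I and - I; the traces of the first and third powers vanish
        for both.\<close>
      by (rule ns[of "?D 1 (-1)" "?D \<i> \<i>"]) (auto simp: 2 calc)
  next
    case 3
    show ?thesis
      \<comment> \<open>Again a matrix and its negative: now the trace vanishes and the trace of the
        cube does not.\<close>
      by (rule ns[of "?D 1 (Complex (-1) 1)" "?D (-1) (Complex 1 (-1))"]) (auto simp: 3 calc)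
  next
    case 4
    show ?thesis
      \<comment> \<open>3^2 + 4^2 = 5^2 preserves the trace of the square, but fourth powers give
        337 and 625. For a corner z + w j with z, w real, the sixth invariants agree iff 625 + 25
        (z^2 + w^2) = 337 + 49 z^2 + w^2, that is z^2 - w^2 = 12; take z = 4, w = 2.\<close>
      by (rule ns[of "mat2 0 (Quat 4 0 2 0) 0 (Quat 0 5 0 0)"
            "mat2 (Quat 0 3 0 0) (Quat 4 0 2 0) 0 (Quat 0 4 0 0)"]) (auto simp: 4 calc)
  next
    case 5
    show ?thesis
      \<comment> \<open>As i j + j i = 0, both matrices square to - I; only the corner of the matrix
        itself differs.\<close>
      by (rule ns[of "?D \<i> \<i>" "mat2 (cq \<i>) qJ 0 (cq \<i>)"]) (auto simp: 5 calc)
  next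
    case 6
    show ?thesis
      \<comment> \<open>The corners have equal modulus, but those of the squares are 2 i and
        0.\<close>
      by (rule ns[of "mat2 (cq \<i>) 1 0 (cq \<i>)" "mat2 (cq \<i>) qJ 0 (cq \<i>)"]) (auto simp: 6 calc)
  qed
qed

theorem theorem3p5:
  shows "(\<forall>A B :: quat ^ 2 ^ 2. Sp_equiv A B \<longleftrightarrow>
            (\<forall>i \<in> {1, 2, 3, 4 :: nat}. Tr (mpow A i) = Tr (mpow B i)) \<and>
            Tr (A ** ctranspose A) = Tr (B ** ctranspose B) \<and>
            Tr (mpow A 2 ** mpow (ctranspose A) 2) = Tr (mpow B 2 ** mpow (ctranspose B) 2)) \<and>
         (\<forall>F. F \<subset> six_invariants \<longrightarrow> \<not> separates_Sp_classes F)"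
  using Sp_equiv_if_same_invariants same_invariants_if_Sp_equiv six_invariants_minimal
  unfolding same_invariants_def by blast

end
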